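(* Let $K$ be any field and let $\mathbf Q=\bigoplus_{n_1,n_2,n_3\ge0}\mathbf Q_{n_1n_2n_3}$ be the $\mathbb N_0^3$-grading of the Lie superalgebra $\mathbf Q=\mathrm{Lie}(v_0,v_1,v_2)$ by multidegree in the generators $v_0,v_1,v_2$. Then $\dim_K\mathbf Q_{n_1n_2n_3}\le 1$ for all $n_1,n_2,n_3\ge 0$.
   Context: $\Lambda$ is the Grassmann algebra over $K$ on odd generators $x_0,x_1,\dots$; $x_i$ is identified with left multiplication; $\partial_i$ is the odd superderivation with $\partial_i(x_j)=\delta_{ij}$; pivot elements $v_i=\sum_{k\ge0}\big(\prod_{n=0}^{k-1}x_{i+3n}x_{i+3n+1}\big)\partial_{i+3k}$. $\mathbf Q$ is the Lie subsuperalgebra of $(\operatorname{End}\Lambda)^{(-)}$ (supercommutator) generated by $v_0,v_1,v_2$ (in characteristic $2$ also closed under squaring of odd elements). $\mathbf Q_{n_1n_2n_3}$ is the span of all Lie products (including squares) in which $v_0,v_1,v_2$ occur $n_1,n_2,n_3$ times respectively; $\mathbf Q$ is the direct sum of these subspaces. *)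

theory Defs
  imports Main
begin

text \<open>Concrete model.  The Grassmann algebra over a field 'k on odd generators
x_0, x_1, ... has as K-basis the ordered monomials x_S = x_{s1} x_{s2} ... x_{sm}
(s1 < ... < sm) for finite S.  A linear operator A on it is encoded by its matrix:
A S T is the coefficient of x_T in A(x_S).  Matrices are zero on infinite S.\<close>

type_synonym 'k op = "nat set \<Rightarrow> nat set \<Rightarrow> 'k"

definition op_comp :: "'k::field op \<Rightarrow> 'k op \<Rightarrow> 'k op" where
  "op_comp A B = (\<lambda>S T. \<Sum>U\<in>{U. B S U \<noteq> 0}. B S U * A U T)"

definition op_id :: "'k::field op" where
  "op_id = (\<lambda>S T. if finite S \<and> T = S then 1 else 0)"

definition op_scale :: "'k::field \<Rightarrow> 'k op \<Rightarrow> 'k op" where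
  "op_scale c A = (\<lambda>S T. c * A S T)"

definition op_add :: "'k::field op \<Rightarrow> 'k op \<Rightarrow> 'k op" where
  "op_add A B = (\<lambda>S T. A S T + B S T)"

definition op_zero :: "'k::field op" where
  "op_zero = (\<lambda>S T. 0)"

definition lmul :: "nat \<Rightarrow> 'k::field op" where
  "lmul i = (\<lambda>S T. if finite S \<and> i \<notin> S \<and> T = insert i S
                    then (-1) ^ card {j\<in>S. j < i} else 0)"

text \<open>The odd superderivation partial_i with partial_i(x_j) = delta_ij.\<close>
definition der :: "nat \<Rightarrow> 'k::field op" where
  "der i = (\<lambda>S T. if finite S \<and> i \<in> S \<and> T = S - {i}
                    then (-1) ^ card {j\<in>S. j < i} else 0)"

primrec xprod :: "nat \<Rightarrow> nat \<Rightarrow> 'k::field op" where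
  "xprod i 0 = op_id"
| "xprod i (Suc k) = op_comp (xprod i k) (op_comp (lmul (i + 3*k)) (lmul (i + 3*k + 1)))"

text \<open>Pivot element v_i = sum_k xprod i k * partial_{i+3k}.  Applied to x_S only the
(finitely many) terms with i+3k in S are nonzero, since partial_{i+3k} kills x_S otherwise.\<close>
definition pivot :: "nat \<Rightarrow> 'k::field op" where
  "pivot i = (\<lambda>S T. \<Sum>k\<in>{k. i + 3*k \<in> S}. op_comp (xprod i k) (der (i + 3*k)) S T)"

type_synonym mdeg = "nat \<times> nat \<times> nat"

definition dadd :: "mdeg \<Rightarrow> mdeg \<Rightarrow> mdeg" where
  "dadd d e = (fst d + fst e, fst (snd d) + fst (snd e), snd (snd d) + snd (snd e))"

definition dtot :: "mdeg \<Rightarrow> nat" where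
  "dtot d = fst d + fst (snd d) + snd (snd d)"

text \<open>Supercommutator of homogeneous elements of multidegrees d, e; their parities are
dtot d mod 2 and dtot e mod 2 (all generators v_i are odd).\<close>
definition sbracket :: "mdeg \<Rightarrow> mdeg \<Rightarrow> 'k::field op \<Rightarrow> 'k op \<Rightarrow> 'k op" where
  "sbracket d e A B = op_add (op_comp A B)
      (op_scale (- ((-1) ^ (dtot d * dtot e))) (op_comp B A))"

inductive lie_mon :: "mdeg \<Rightarrow> 'k::field op \<Rightarrow> bool" where
  gen0: "lie_mon (1,0,0) (pivot 0)"
| gen1: "lie_mon (0,1,0) (pivot 1)"
| gen2: "lie_mon (0,0,1) (pivot 2)"
| br: "lie_mon d A \<Longrightarrow> lie_mon e B \<Longrightarrow> lie_mon (dadd d e) (sbracket d e A B)"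
| sq: "lie_mon d A \<Longrightarrow> odd (dtot d) \<Longrightarrow> lie_mon (dadd d d) (op_comp A A)"

inductive_set Qcomp :: "mdeg \<Rightarrow> 'k::field op set" for d where
  zero: "op_zero \<in> Qcomp d"
| step: "lie_mon d A \<Longrightarrow> q \<in> Qcomp d \<Longrightarrow> op_add (op_scale c A) q \<in> Qcomp d"

end

theory Submission
  imports Defs
begin

text \<open>
  The pivots satisfy \<open>v\<^sub>i = \<partial>\<^sub>i + x\<^sub>i x\<^sub>i\<^sub>+\<^sub>1 v\<^sub>i\<^sub>+\<^sub>3\<close>. From this the supercommutator of two monomials
  \<open>x\<^sub>S v\<^sub>n\<close> and \<open>x\<^sub>T v\<^sub>m\<close>, and the square of an odd one, is again a scalar multiple of a monomial.
  Moreover every monomial obtained from the generators is admissible: \<open>S\<close> lies in \<open>{0..n-2}\<close> and does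
  not contain both \<open>n-3\<close> and \<open>n-2\<close>.

  Multidegrees are read off by giving \<open>v\<^sub>i\<close> weight \<open>t\<^sup>i\<close> and \<open>x\<^sub>i\<close> weight \<open>-t\<^sup>i\<close> in
  \<open>\<int>[t]/(t\<^sup>3 - t - 2)\<close>. There \<open>t\<close> has residue ring \<open>\<int>/2\<close>, so the weight determines the base-\<open>t\<close> digits of
  \<open>\<Sum>s\<in>S. t\<^sup>s\<close> up to the relation \<open>t\<^sup>i = t\<^sup>i\<^sup>+\<^sup>3 - t\<^sup>i - t\<^sup>i\<^sup>+\<^sup>1\<close>, which identifies \<open>x\<^sub>S v\<^sub>n\<close> with
  \<open>x\<^sub>S x\<^sub>n x\<^sub>n\<^sub>+\<^sub>1 v\<^sub>n\<^sub>+\<^sub>3\<close>; admissibility excludes the latter. Hence a multidegree contains at most one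
  admissible monomial.
\<close>

section \<open>Weights\<close>

text \<open>The integer-valued solutions \<open>f\<close> of the recursion are the additive functionals of the weight,
  with \<open>f i\<close> the value at \<open>t\<^sup>i\<close>.\<close>
definition pivot_rec :: "(nat \<Rightarrow> int) \<Rightarrow> bool" where
  "pivot_rec f \<longleftrightarrow> (\<forall>i. f (i + 3) = 2 * f i + f (i + 1))"

definition weight :: "(nat \<Rightarrow> int) \<Rightarrow> nat set \<Rightarrow> nat \<Rightarrow> int" where
  "weight f S n = f n - sum f S"

text \<open>The ring \<open>\<int>[t]/(t^3 - t - 2)\<close> is free of rank 3 over the integers, so
  testing against all functionals expresses equality of weights without constructing the
  ring.\<close>

definition same_weight :: "nat set \<Rightarrow> nat \<Rightarrow> nat set \<Rightarrow> nat \<Rightarrow> bool" where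
  "same_weight S n T m \<longleftrightarrow> (\<forall>f. pivot_rec f \<longrightarrow> weight f S n = weight f T m)"

text \<open>Written with addition, because truncated subtraction would let \<open>0\<close> into
  \<open>S\<close> when \<open>n < 2\<close>.\<close>

definition admissible :: "nat \<Rightarrow> nat set \<Rightarrow> bool" where
  "admissible n S \<longleftrightarrow> (\<forall>s\<in>S. s + 2 \<le> n) \<and> (\<forall>s. s \<in> S \<longrightarrow> Suc s \<in> S \<longrightarrow> s + 3 \<noteq> n)"

section \<open>Solutions of the recursion modulo 2\<close>

fun pivot_seq :: "int \<Rightarrow> int \<Rightarrow> int \<Rightarrow> nat \<Rightarrow> int" where
  "pivot_seq a b c 0 = a"
| "pivot_seq a b c (Suc 0) = b"
| "pivot_seq a b c (Suc (Suc 0)) = c"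
| "pivot_seq a b c (Suc (Suc (Suc i))) = 2 * pivot_seq a b c i + pivot_seq a b c (Suc i)"

lemma pivot_rec_pivot_seq: "pivot_rec (pivot_seq a b c)"
  by (simp add: pivot_rec_def numeral_3_eq_3)

text \<open>Modulo 2 the recursion reads \<open>f (i + 3) = f (i + 1)\<close>; this solution is the
  residue map \<open>t = 0\<close>.\<close>

lemma even_pivot_seq_100_iff: "even (pivot_seq 1 0 0 i) \<longleftrightarrow> i \<noteq> 0"
  by (induction "1::int" "0::int" "0::int" i rule: pivot_seq.induct) auto

lemma odd_pivot_seq_111: "odd (pivot_seq 1 1 1 i)"
  by (induction "1::int" "1::int" "1::int" i rule: pivot_seq.induct) auto

text \<open>This solution is the residue map \<open>t = 1\<close>, so only the number of factors
  counts. Being 1 at the indices 0, 1, 2, it also computes the total degree later.\<close>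

lemma even_weight_111_iff:
  assumes "finite S"
  shows "even (weight (pivot_seq 1 1 1) S n) \<longleftrightarrow> odd (card S)"
proof -
  have "even (sum (pivot_seq 1 1 1) S) \<longleftrightarrow> even (card S)"
    using assms by (induction S rule: finite_induct) (auto simp: odd_pivot_seq_111)
  then show ?thesis by (simp add: weight_def odd_pivot_seq_111)
qed

text \<open>Only the digit at \<open>t^0\<close> survives. The two disjuncts never cancel, since
  \<open>n = 0\<close> forces \<open>S\<close> to be empty.\<close>

lemma odd_weight_100_iff:
  assumes "S \<subseteq> {..<n}"
  shows "odd (weight (pivot_seq 1 0 0) S n) \<longleftrightarrow> n = 0 \<or> 0 \<in> S"
proof -
  have fin: "finite S" using assms finite_subset by blast
  have "even (sum (pivot_seq 1 0 0) (S - {0}))"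
    by (rule dvd_sum) (simp add: even_pivot_seq_100_iff)
  moreover have "sum (pivot_seq 1 0 0) S = (if 0 \<in> S then 1 else 0) + sum (pivot_seq 1 0 0) (S - {0})"
    using fin by (simp add: sum.remove)
  ultimately have "even (sum (pivot_seq 1 0 0) S) \<longleftrightarrow> 0 \<notin> S" by auto
  then show ?thesis using assms by (auto simp: weight_def even_pivot_seq_100_iff)
qed

section \<open>Comparing weights digit by digit\<close>

lemma same_weight_zero_digit:
  assumes "same_weight S n T m" "S \<subseteq> {..<n}" "T \<subseteq> {..<m}"
  shows "n = 0 \<or> 0 \<in> S \<longleftrightarrow> m = 0 \<or> 0 \<in> T"
  using assms odd_weight_100_iff pivot_rec_pivot_seq unfolding same_weight_def by metis

text \<open>Division by \<open>t\<close>: the digit at \<open>t^0\<close> is split off and the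
  remaining exponents drop by one.\<close>

lemma weight_shift:
  assumes "finite S"
  shows "weight f S (Suc n) = weight (\<lambda>i. f (Suc i)) {s. Suc s \<in> S} n - (if 0 \<in> S then f 0 else 0)"
proof -
  have "sum f (S - {0}) = sum f (Suc ` {s. Suc s \<in> S})"
    by (rule arg_cong[where f = "sum f"]) (auto simp: image_iff gr0_conv_Suc, metis not0_implies_Suc)
  also have "\<dots> = (\<Sum>s | Suc s \<in> S. f (Suc s))"
    by (subst sum.reindex) auto
  finally show ?thesis using assms by (auto simp: weight_def sum.remove)
qed

text \<open>The shift is not onto on integer solutions of the recursion, but its image contains
  every doubled solution.\<close>
lemma same_weight_shift:
  assumes sw: "same_weight S (Suc n) T (Suc m)" and fin: "finite S" "finite T"
    and zero: "0 \<in> S \<longleftrightarrow> 0 \<in> T"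
  shows "same_weight {s. Suc s \<in> S} n {s. Suc s \<in> T} m"
  unfolding same_weight_def
proof (intro allI impI)
  fix g assume g: "pivot_rec g"
  \<comment> \<open>The value at 0 is forced by \<open>f 3 = 2 * f 0 + f 1\<close>. The factor 2 in
    the other values makes it an integer and cancels at the end.\<close>
  define f where "f = (\<lambda>i. case i of 0 \<Rightarrow> g 2 - g 0 | Suc j \<Rightarrow> 2 * g j)"
  have g3: "g (Suc (Suc (Suc j))) = 2 * g j + g (Suc j)" for j
    using g by (simp add: pivot_rec_def numeral_3_eq_3)
  have "pivot_rec f"
    unfolding pivot_rec_def
  proof
    fix i show "f (i + 3) = 2 * f i + f (i + 1)"
      by (cases i) (auto simp: f_def numeral_3_eq_3 numeral_2_eq_2 g3)
  qed
  then have "weight f S (Suc n) = weight f T (Suc m)"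
    using sw by (simp add: same_weight_def)
  then have "weight (\<lambda>i. f (Suc i)) {s. Suc s \<in> S} n = weight (\<lambda>i. f (Suc i)) {s. Suc s \<in> T} m"
    using fin zero by (simp add: weight_shift)
  then show "weight g {s. Suc s \<in> S} n = weight g {s. Suc s \<in> T} m"
    by (simp add: f_def weight_def sum_distrib_left[symmetric])
qed

text \<open>Weights see \<open>v\<^sub>0\<close> and \<open>x\<^sub>0 x\<^sub>1 v\<^sub>3\<close> as equal, and iterating this replacement is the only
  ambiguity.\<close>
lemma same_weight_pivot_zero:
  assumes "same_weight {} 0 S m" "S \<subseteq> {..<m}" "m > 0"
  shows "\<exists>s. s \<in> S \<and> Suc s \<in> S \<and> s + 3 = m"
  using assms
proof (induction m arbitrary: S rule: less_induct)
  case (less m)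
  note sub = less.prems(2)
  have fin: "finite S" using sub finite_subset by blast
  \<comment> \<open>Replacing \<open>v_0\<close> by \<open>x_0 x_1 v_3\<close> makes room for three
    divisions by \<open>t\<close>.\<close>
  have "weight f {0, 1} 3 = weight f {} 0" if "pivot_rec f" for f
    using that[unfolded pivot_rec_def, rule_format, of 0] by (simp add: weight_def)
  then have sw0: "same_weight {0, 1} 3 S m"
    using less.prems(1) by (simp add: same_weight_def)
  obtain m1 where m1: "m = Suc m1" using less.prems(3) gr0_conv_Suc by auto
  have z0: "0 \<in> S" using same_weight_zero_digit[OF sw0 _ sub] m1 by auto
  \<comment> \<open>The digit test cannot exclude \<open>m = 1\<close>, but the integer values under
    \<open>pivot_seq 1 0 0\<close> can: 1 on the left against -1 on the right.\<close>
  have ne1: "m1 \<noteq> 0"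
  proof
    assume "m1 = 0"
    then have "S = {0}" using sub z0 m1 by auto
    then show False
      using sw0[unfolded same_weight_def, rule_format, OF pivot_rec_pivot_seq[of 1 0 0]] m1 \<open>m1 = 0\<close>
      by (simp add: weight_def numeral_3_eq_3)
  qed
  have "{s. Suc s \<in> {0, 1::nat}} = {0}" by auto
  then have sw1: "same_weight {0} 2 {s. Suc s \<in> S} m1"
    using same_weight_shift[of "{0,1}" 2 S m1] sw0 m1 fin z0 by (simp add: numeral_3_eq_3 numeral_2_eq_2)
  have sub1: "{s. Suc s \<in> S} \<subseteq> {..<m1}" using sub m1 by auto
  have z1: "Suc 0 \<in> S" using same_weight_zero_digit[OF sw1 _ sub1] ne1 by auto
  obtain m2 where m2: "m1 = Suc m2" using ne1 not0_implies_Suc by auto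
  have "{s. Suc s \<in> {0::nat}} = {}" by auto
  moreover have "finite {s. Suc s \<in> S}" using sub1 finite_subset by blast
  ultimately have sw2: "same_weight {} 1 {s. Suc (Suc s) \<in> S} m2"
    using same_weight_shift[of "{0}" 1 "{s. Suc s \<in> S}" m2] sw1 m2 z1 by (simp add: numeral_2_eq_2)
  have sub2: "{s. Suc (Suc s) \<in> S} \<subseteq> {..<m2}" using sub1 m2 by auto
  have z2: "m2 \<noteq> 0" "Suc (Suc 0) \<notin> S" using same_weight_zero_digit[OF sw2 _ sub2] by auto
  obtain m3 where m3: "m2 = Suc m3" using z2 not0_implies_Suc by auto
  \<comment> \<open>The third division brings the left side back to \<open>v_0\<close>, so the
    induction hypothesis applies, unless \<open>m = 3\<close> and the pair sought is
    \<open>0, 1\<close>.\<close>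
  have "finite {s. Suc (Suc s) \<in> S}" using sub2 finite_subset by blast
  then have sw3: "same_weight {} 0 {s. Suc (Suc (Suc s)) \<in> S} m3"
    using same_weight_shift[of "{}" 0 "{s. Suc (Suc s) \<in> S}" m3] sw2 m3 z2 by simp
  have sub3: "{s. Suc (Suc (Suc s)) \<in> S} \<subseteq> {..<m3}" using sub2 m3 by auto
  show ?case
  proof (cases "m3 = 0")
    case True
    then show ?thesis using z0 z1 m1 m2 m3 by auto
  next
    case False
    then obtain s where "Suc (Suc (Suc s)) \<in> S" "Suc (Suc (Suc (Suc s))) \<in> S" "s + 3 = m3"
      using less.IH[OF _ sw3 sub3] m1 m2 m3 by auto
    then show ?thesis using m1 m2 m3 by (intro exI[of _ "Suc (Suc (Suc s))"]) auto
  qed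
qed

lemma admissible_subset: "admissible n S \<Longrightarrow> S \<subseteq> {..<n}"
  by (force simp: admissible_def)

lemma admissible_shift: "admissible (Suc n) S \<Longrightarrow> admissible n {s. Suc s \<in> S}"
  unfolding admissible_def by force

lemma same_weight_sym: "same_weight S n T m \<Longrightarrow> same_weight T m S n"
  by (simp add: same_weight_def)

text \<open>The lowest digits agree, and induction divides both sides by \<open>t\<close>. Once one
  side is down to \<open>v_0\<close>, any other candidate carries the pair that admissibility
  forbids.\<close>

lemma admissible_same_weight_unique:
  assumes "same_weight S n T m" "admissible n S" "admissible m T"
  shows "S = T \<and> n = m"
  using assms
proof (induction n arbitrary: S T m)
  case 0
  then have S: "S = {}" by (auto simp: admissible_def)
  have "m = 0"
    using same_weight_pivot_zero[of T m] 0 S admissible_subset unfolding admissible_def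
    by (metis gr0I)
  then show ?case using 0 S by (auto simp: admissible_def)
next
  case (Suc n)
  note sub = admissible_subset[OF Suc.prems(2)] admissible_subset[OF Suc.prems(3)]
  have fin: "finite S" "finite T" using sub finite_subset by blast+
  show ?case
  proof (cases m)
    case 0
    then have "T = {}" using Suc.prems by (auto simp: admissible_def)
    then have "\<exists>s. s \<in> S \<and> Suc s \<in> S \<and> s + 3 = Suc n"
      using same_weight_pivot_zero[of S "Suc n"] same_weight_sym[OF Suc.prems(1)] sub 0 by auto
    then show ?thesis using Suc.prems(2) by (auto simp: admissible_def)
  next
    case (Suc m')
    have z: "0 \<in> S \<longleftrightarrow> 0 \<in> T"
      using same_weight_zero_digit[OF Suc.prems(1) sub] Suc by auto
    have "{s. Suc s \<in> S} = {s. Suc s \<in> T} \<and> n = m'"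
      using Suc.IH same_weight_shift[of S n T m'] Suc.prems Suc fin z admissible_shift by metis
    moreover have "s \<in> S \<longleftrightarrow> s \<in> T" if "{s. Suc s \<in> S} = {s. Suc s \<in> T}" for s
      using that z by (cases s) auto
    ultimately show ?thesis using Suc by blast
  qed
qed

section \<open>Row-finite operators as a ring\<close>

text \<open>Finite rows make the sums in \<open>op_comp\<close> genuine, as associativity requires;
  vanishing at infinite sets makes \<open>op_id\<close> a two-sided unit.\<close>

definition row_finite :: "'k::field op \<Rightarrow> bool" where
  "row_finite A \<longleftrightarrow> (\<forall>S. finite {T. A S T \<noteq> 0} \<and> (\<forall>T. A S T \<noteq> 0 \<longrightarrow> finite S \<and> finite T))"

typedef (overloaded) 'k rop = "{A :: 'k::field op. row_finite A}"
  morphisms mat Rop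
  by (rule exI[of _ op_zero]) (simp add: op_zero_def row_finite_def)

setup_lifting type_definition_rop

lemma finite_row: "finite {T. mat A S T \<noteq> 0}"
  using mat[of A] by (auto simp: row_finite_def)

lemma mat_infinite: "infinite S \<or> infinite T \<Longrightarrow> mat A S T = 0"
  using mat[of A] by (auto simp: row_finite_def)

lemma op_comp_superset:
  assumes "finite F" "{U. B S U \<noteq> 0} \<subseteq> F"
  shows "op_comp A B S T = (\<Sum>U\<in>F. B S U * A U T)"
  unfolding op_comp_def by (rule sum.mono_neutral_left) (use assms in auto)

lemma op_comp_single:
  assumes "\<And>V. B S V = (if V = U then b else 0)"
  shows "op_comp A B S T = b * A U T"
proof -
  have "{V. B S V \<noteq> 0} \<subseteq> {U}" using assms by auto
  then show ?thesis using op_comp_superset[of "{U}" B S A T] assms by simp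
qed

lemma op_comp_support: "{T. op_comp A B S T \<noteq> 0} \<subseteq> (\<Union>U\<in>{U. B S U \<noteq> 0}. {T. A U T \<noteq> 0})"
proof
  fix T assume "T \<in> {T. op_comp A B S T \<noteq> 0}"
  then obtain U where "B S U \<noteq> 0" "B S U * A U T \<noteq> 0"
    unfolding op_comp_def by (auto elim: sum.not_neutral_contains_not_neutral)
  then show "T \<in> (\<Union>U\<in>{U. B S U \<noteq> 0}. {T. A U T \<noteq> 0})" by auto
qed

lemma row_finite_add:
  assumes "row_finite A" "row_finite B"
  shows "row_finite (op_add A B)"
  unfolding row_finite_def
proof (intro allI conjI impI)
  fix S
  have "finite ({T. A S T \<noteq> 0} \<union> {T. B S T \<noteq> 0})" using assms by (auto simp: row_finite_def)
  then show "finite {T. op_add A B S T \<noteq> 0}"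
    by (rule rev_finite_subset) (auto simp: op_add_def)
  fix T assume "op_add A B S T \<noteq> 0"
  then have "A S T \<noteq> 0 \<or> B S T \<noteq> 0" by (auto simp: op_add_def)
  then show "finite S" and "finite T" using assms unfolding row_finite_def by blast+
qed

lemma row_finite_comp:
  assumes "row_finite A" "row_finite B"
  shows "row_finite (op_comp A B)"
  unfolding row_finite_def
proof (intro allI conjI impI)
  fix S
  have "finite (\<Union>U\<in>{U. B S U \<noteq> 0}. {T. A U T \<noteq> 0})" using assms by (auto simp: row_finite_def)
  then show "finite {T. op_comp A B S T \<noteq> 0}"
    by (rule rev_finite_subset) (rule op_comp_support)
  fix T assume "op_comp A B S T \<noteq> 0"
  then obtain U where "B S U \<noteq> 0" "A U T \<noteq> 0" using op_comp_support[of A B S] by blast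
  then show "finite S" and "finite T" using assms unfolding row_finite_def by blast+
qed

lemma row_finite_single:
  assumes "\<And>S T. A S T \<noteq> 0 \<Longrightarrow> finite S \<and> finite T \<and> T = g S"
  shows "row_finite A"
  unfolding row_finite_def
proof (intro allI conjI)
  fix S show "finite {T. A S T \<noteq> 0}"
    by (rule finite_subset[of _ "{g S}"]) (use assms in auto)
qed (use assms in auto)

instantiation rop :: (field) ring_1
begin

lift_definition zero_rop :: "'a rop" is op_zero
  by (simp add: op_zero_def row_finite_def)

lift_definition one_rop :: "'a rop" is op_id
  by (rule row_finite_single[of _ id]) (simp add: op_id_def split: if_splits)

lift_definition plus_rop :: "'a rop \<Rightarrow> 'a rop \<Rightarrow> 'a rop" is op_add
  by (rule row_finite_add)

lift_definition uminus_rop :: "'a rop \<Rightarrow> 'a rop" is "op_scale (- 1)"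
  by (auto simp: op_scale_def row_finite_def)

lift_definition times_rop :: "'a rop \<Rightarrow> 'a rop \<Rightarrow> 'a rop" is op_comp
  by (rule row_finite_comp)

definition minus_rop :: "'a rop \<Rightarrow> 'a rop \<Rightarrow> 'a rop" where
  "minus_rop A B = A + (- B)"

lemma mat_mult_superset:
  fixes A B :: "'a rop"
  assumes "finite F" "{U. mat B S U \<noteq> 0} \<subseteq> F"
  shows "mat (A * B) S T = (\<Sum>U\<in>F. mat B S U * mat A U T)"
  using op_comp_superset[of F "mat B", OF assms] by (simp add: times_rop.rep_eq)

lemma mat_mult:
  fixes A B :: "'a rop"
  shows "mat (A * B) S T = (\<Sum>U | mat B S U \<noteq> 0. mat B S U * mat A U T)"
  by (rule mat_mult_superset[OF finite_row order_refl])

lemma mat_add: "mat (A + B) S T = mat A S T + mat B S T" for A B :: "'a rop"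
  by (simp add: plus_rop.rep_eq op_add_def)

instance
proof
  fix A B C :: "'a rop"
  show "A * B * C = A * (B * C)"
  proof (intro mat_inject[THEN iffD1] ext)
    fix S T
    \<comment> \<open>The states reachable by \<open>C\<close> followed by \<open>B\<close>: a
      common finite index set over which the two sums can be exchanged.\<close>
    let ?F = "\<Union>U\<in>{U. mat C S U \<noteq> 0}. {V. mat B U V \<noteq> 0}"
    have F: "finite ?F" by (simp add: finite_row)
    have "mat (A * B * C) S T
        = (\<Sum>U | mat C S U \<noteq> 0. mat C S U * (\<Sum>V\<in>?F. mat B U V * mat A V T))"
      by (subst mat_mult, rule sum.cong[OF refl], subst mat_mult_superset[OF F]) auto
    also have "\<dots> = (\<Sum>V\<in>?F. (\<Sum>U | mat C S U \<noteq> 0. mat C S U * mat B U V) * mat A V T)"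
      by (simp add: sum_distrib_left sum_distrib_right mult.assoc) (rule sum.swap)
    also have "\<dots> = (\<Sum>V\<in>?F. mat (B * C) S V * mat A V T)"
      by (simp add: mat_mult)
    also have "\<dots> = mat (A * (B * C)) S T"
      by (rule mat_mult_superset[OF F, symmetric])
        (use op_comp_support[of "mat B" "mat C" S] in \<open>simp add: times_rop.rep_eq\<close>)
    finally show "mat (A * B * C) S T = mat (A * (B * C)) S T" .
  qed
  show "A + B + C = A + (B + C)" "A + B = B + A" "0 + A = A" "- A + A = 0"
    by (transfer, auto simp: op_add_def op_zero_def op_scale_def fun_eq_iff)+
  show "A - B = A + - B" by (simp add: minus_rop_def)
  show "(0::'a rop) \<noteq> 1"
    by transfer (auto simp: op_zero_def op_id_def fun_eq_iff intro!: exI[of _ "{}"])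
  show "1 * A = A"
  proof (intro mat_inject[THEN iffD1] ext)
    fix S T
    have "mat (1 * A) S T = (\<Sum>U\<in>insert T {U. mat A S U \<noteq> 0}. mat A S U * mat 1 U T)"
      by (rule mat_mult_superset) (auto simp: finite_row)
    also have "\<dots> = (\<Sum>U\<in>insert T {U. mat A S U \<noteq> 0}. if U = T then mat A S T else 0)"
      by (rule sum.cong) (auto simp: one_rop.rep_eq op_id_def mat_infinite)
    also have "\<dots> = mat A S T" by (subst sum.delta) (auto simp: finite_row)
    finally show "mat (1 * A) S T = mat A S T" .
  qed
  show "A * 1 = A"
  proof (intro mat_inject[THEN iffD1] ext)
    fix S T
    have "mat (A * 1) S T = (if finite S then 1 else 0) * mat A S T"
      unfolding times_rop.rep_eq by (rule op_comp_single) (auto simp: one_rop.rep_eq op_id_def)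
    then show "mat (A * 1) S T = mat A S T" by (simp add: mat_infinite)
  qed
  show "(A + B) * C = A * C + B * C"
    by (intro mat_inject[THEN iffD1] ext)
      (simp add: mat_add mat_mult distrib_left sum.distrib)
  show "A * (B + C) = A * B + A * C"
  proof (intro mat_inject[THEN iffD1] ext)
    fix S T
    let ?F = "{U. mat B S U \<noteq> 0} \<union> {U. mat C S U \<noteq> 0}"
    have F: "finite ?F" by (simp add: finite_row)
    have "mat (A * D) S T = (\<Sum>U\<in>?F. mat D S U * mat A U T)" if "D \<in> {B, C, B + C}" for D
      by (rule mat_mult_superset[OF F]) (use that in \<open>auto simp: mat_add\<close>)
    then show "mat (A * (B + C)) S T = mat (A * B + A * C) S T"
      by (simp add: mat_add distrib_right sum.distrib)
  qed
qed

end

text \<open>Scalars enter as central ring elements, so that scaled operators are handled by ring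
  identities alone.\<close>

lift_definition scal :: "'k::field \<Rightarrow> 'k rop" is "\<lambda>c. op_scale c op_id"
  by (rule row_finite_single[of _ id]) (simp add: op_scale_def op_id_def split: if_splits)

lemma mat_scal_mult: "mat (scal c * A) = op_scale c (mat A)"
proof (intro ext)
  fix S T
  have "mat (scal c * A) S T = (\<Sum>U\<in>insert T {U. mat A S U \<noteq> 0}. mat A S U * mat (scal c) U T)"
    by (rule mat_mult_superset) (auto simp: finite_row)
  also have "\<dots> = (\<Sum>U\<in>insert T {U. mat A S U \<noteq> 0}. if U = T then c * mat A S T else 0)"
    by (rule sum.cong) (auto simp: scal.rep_eq op_scale_def op_id_def mat_infinite)
  also have "\<dots> = op_scale c (mat A) S T"
    by (subst sum.delta) (auto simp: finite_row op_scale_def)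
  finally show "mat (scal c * A) S T = op_scale c (mat A) S T" .
qed

lemma scal_commute: "A * scal c = scal c * A"
proof (intro mat_inject[THEN iffD1] ext)
  fix S T
  have "mat (A * scal c) S T = (if finite S then c else 0) * mat A S T"
    unfolding times_rop.rep_eq by (rule op_comp_single) (auto simp: scal.rep_eq op_scale_def op_id_def)
  then show "mat (A * scal c) S T = mat (scal c * A) S T"
    by (simp add: mat_infinite mat_scal_mult op_scale_def)
qed

lemma scal_mult: "scal a * scal b = scal (a * b)"
  by (intro mat_inject[THEN iffD1]) (simp add: mat_scal_mult, simp add: scal.rep_eq op_scale_def mult.assoc)

lemma scal_0 [simp]: "scal 0 = 0" and scal_1 [simp]: "scal 1 = 1" and scal_uminus: "scal (- c) = - scal c"
  and scal_add: "scal (a + b) = scal a + scal b"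
  by (transfer, auto simp: op_scale_def op_zero_def op_id_def op_add_def fun_eq_iff)+

section \<open>Clifford relations between \<open>xop\<close> and \<open>dop\<close>\<close>

lift_definition xop :: "nat \<Rightarrow> 'k::field rop" is lmul
  by (rule row_finite_single) (simp add: lmul_def split: if_splits)

lift_definition dop :: "nat \<Rightarrow> 'k::field rop" is der
  by (rule row_finite_single) (simp add: der_def split: if_splits)

definition below_sign :: "nat \<Rightarrow> nat set \<Rightarrow> 'k::field" where
  "below_sign i S = (-1) ^ card {j\<in>S. j < i}"

lemma below_sign_insert:
  assumes "finite S" "j \<notin> S"
  shows "below_sign i (insert j S) = (if j < i then - below_sign i S else below_sign i S)"
proof -
  have "{k \<in> insert j S. k < i} = (if j < i then insert j {k \<in> S. k < i} else {k \<in> S. k < i})" by auto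
  then show ?thesis using assms by (simp add: below_sign_def)
qed

lemma below_sign_remove:
  assumes "finite S" "j \<in> S"
  shows "(below_sign i (S - {j}) :: 'k::field) = (if j < i then - below_sign i S else below_sign i S)"
proof -
  have "(below_sign i S :: 'k) = (if j < i then - below_sign i (S - {j}) else below_sign i (S - {j}))"
    using below_sign_insert[of "S - {j}" j i] assms by (simp add: insert_absorb)
  then show ?thesis by (simp split: if_splits)
qed

lemma below_sign_sq [simp]: "below_sign i S * below_sign i S = 1"
  by (simp add: below_sign_def flip: power_add)

text \<open>The right factor acts first and sends a basis monomial to a signed basis monomial or to
  0, so the sum collapses and the relations below become comparisons of signs.\<close>

lemma mat_mult_x:
  "mat (A * xop i) S T = (if finite S \<and> i \<notin> S then below_sign i S * mat A (insert i S) T else 0)"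
proof -
  have "mat (A * xop i) S T = (if finite S \<and> i \<notin> S then below_sign i S else 0) * mat A (insert i S) T"
    unfolding times_rop.rep_eq
    by (rule op_comp_single) (auto simp: xop.rep_eq lmul_def below_sign_def)
  then show ?thesis by simp
qed

lemma mat_mult_d:
  "mat (A * dop i) S T = (if finite S \<and> i \<in> S then below_sign i S * mat A (S - {i}) T else 0)"
proof -
  have "mat (A * dop i) S T = (if finite S \<and> i \<in> S then below_sign i S else 0) * mat A (S - {i}) T"
    unfolding times_rop.rep_eq
    by (rule op_comp_single) (auto simp: dop.rep_eq der_def below_sign_def)
  then show ?thesis by simp
qed

lemma mat_x: "mat (xop i) S T = (if finite S \<and> i \<notin> S \<and> T = insert i S then below_sign i S else 0)"
  by (simp add: xop.rep_eq lmul_def below_sign_def)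

lemma mat_d: "mat (dop i) S T = (if finite S \<and> i \<in> S \<and> T = S - {i} then below_sign i S else 0)"
  by (simp add: dop.rep_eq der_def below_sign_def)

lemma mat_uminus: "mat (- A) S T = - mat A S T"
  by (simp add: uminus_rop.rep_eq op_scale_def)

lemma x_sq [simp]: "xop i * xop i = 0"
  by (intro mat_inject[THEN iffD1] ext) (auto simp: mat_mult_x mat_x zero_rop.rep_eq op_zero_def)

lemma d_sq [simp]: "dop i * dop i = 0"
  by (intro mat_inject[THEN iffD1] ext) (auto simp: mat_mult_d mat_d zero_rop.rep_eq op_zero_def)

lemma x_anticomm: "i \<noteq> j \<Longrightarrow> xop i * xop j = - (xop j * xop i)"
  by (intro mat_inject[THEN iffD1] ext)
    (auto simp: mat_mult_x mat_x mat_uminus below_sign_insert insert_commute)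

lemma d_anticomm: "i \<noteq> j \<Longrightarrow> dop i * dop j = - (dop j * dop i)"
  by (intro mat_inject[THEN iffD1] ext)
    (auto simp: mat_mult_d mat_d mat_uminus below_sign_remove insert_commute)

lemma d_x_anticomm: "i \<noteq> j \<Longrightarrow> dop i * xop j = - (xop j * dop i)"
  by (intro mat_inject[THEN iffD1] ext)
    (auto simp: mat_mult_d mat_mult_x mat_x mat_d mat_uminus below_sign_remove below_sign_insert insert_commute insert_Diff_if)

lemma d_x_same: "(dop i :: 'k::field rop) * xop i = 1 - xop i * dop i"
proof -
  have "dop i * xop i + xop i * dop i = (1 :: 'k::field rop)"
    by (intro mat_inject[THEN iffD1] ext)
      (auto simp: mat_mult_d mat_mult_x mat_x mat_d mat_add below_sign_remove below_sign_insert insert_absorb one_rop.rep_eq op_id_def)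
  then show ?thesis by (simp add: algebra_simps)
qed

section \<open>Pivot elements\<close>

primrec xpairs :: "nat \<Rightarrow> nat \<Rightarrow> 'k::field rop" where
  "xpairs i 0 = 1"
| "xpairs i (Suc k) = xpairs i k * (xop (i + 3 * k) * xop (i + 3 * k + 1))"

lemma mat_xpairs: "mat (xpairs i k) = xprod i k"
  by (induction k) (auto simp: one_rop.rep_eq times_rop.rep_eq xop.rep_eq)

text \<open>The defining recursion appends pairs on the right, while the pivot recursion needs the
  leftmost pair in front.\<close>

lemma xpairs_Suc: "xpairs i (Suc k) = xop i * xop (Suc i) * xpairs (i + 3) k"
  by (induction k) (simp_all add: mult.assoc add_ac)

lemma pivot_eq: "pivot i S T = (\<Sum>k | i + 3 * k \<in> S. mat (xpairs i k * dop (i + 3 * k)) S T)"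
  by (simp add: pivot_def times_rop.rep_eq mat_xpairs dop.rep_eq)

lift_definition vop :: "nat \<Rightarrow> 'k::field rop" is pivot
  unfolding row_finite_def
proof (intro allI conjI impI)
  fix i S
  have inj: "inj_on (\<lambda>k. i + 3 * k) A" for A :: "nat set" by (auto simp: inj_on_def)
  show "finite {T. pivot i S T \<noteq> (0::'k)}"
  proof (cases "finite S")
    case True
    have "finite ((\<lambda>k. i + 3 * k) ` {k. i + 3 * k \<in> S})"
      by (rule finite_subset[OF _ True]) auto
    then have "finite {k. i + 3 * k \<in> S}" using finite_imageD inj by blast
    then have "finite (\<Union>k\<in>{k. i + 3 * k \<in> S}. {T. mat (xpairs i k * dop (i + 3 * k) :: 'k rop) S T \<noteq> 0})"
      by (simp add: finite_row)
    moreover have "{T. pivot i S T \<noteq> (0::'k)}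
        \<subseteq> (\<Union>k\<in>{k. i + 3 * k \<in> S}. {T. mat (xpairs i k * dop (i + 3 * k) :: 'k rop) S T \<noteq> 0})"
      by (auto simp: pivot_eq elim: sum.not_neutral_contains_not_neutral)
    ultimately show ?thesis by (rule rev_finite_subset)
  qed (simp add: pivot_eq mat_infinite)
  fix T assume "pivot i S T \<noteq> (0::'k)"
  then obtain k where "mat (xpairs i k * dop (i + 3 * k) :: 'k rop) S T \<noteq> 0"
    unfolding pivot_eq by (auto elim: sum.not_neutral_contains_not_neutral)
  then show "finite S" and "finite T" using mat_infinite by blast+
qed

text \<open>Pivots are infinite sums, but on \<open>x_S\<close> they agree with these partial sums
  once \<open>N\<close> bounds \<open>S\<close>. Identities are proved by induction on
  \<open>N\<close> and transferred row by row.\<close>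

definition vtrunc :: "nat \<Rightarrow> nat \<Rightarrow> 'k::field rop" where
  "vtrunc i N = (\<Sum>k<N. xpairs i k * dop (i + 3 * k))"

lemma vtrunc_Suc: "vtrunc i (Suc N) = dop i + xop i * xop (Suc i) * vtrunc (i + 3) N"
  unfolding vtrunc_def sum.lessThan_Suc_shift
  by (simp only: xpairs_Suc) (simp add: sum_distrib_left mult.assoc add_ac)

lemma mat_sum: "mat (sum F K) S T = (\<Sum>k\<in>K. mat (F k) S T)" for F :: "'b \<Rightarrow> 'k::field rop"
  by (induction K rule: infinite_finite_induct) (auto simp: mat_add zero_rop.rep_eq op_zero_def)

lemma mat_vop_trunc:
  assumes "\<forall>s\<in>S. s < N"
  shows "mat (vop i :: 'k::field rop) S T = mat (vtrunc i N) S T"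
proof -
  have "(\<Sum>k | i + 3 * k \<in> S. mat (xpairs i k * dop (i + 3 * k) :: 'k::field rop) S T)
      = (\<Sum>k<N. mat (xpairs i k * dop (i + 3 * k)) S T)"
    by (rule sum.mono_neutral_left) (use assms in force, use assms in force, simp add: mat_mult_d)
  then show ?thesis by (simp add: vop.rep_eq pivot_eq vtrunc_def mat_sum)
qed

lemma mat_mult_row_cong:
  "(\<And>U. mat B S U = mat B' S U) \<Longrightarrow> mat (A * B) S T = mat (A * B') S T"
  by (simp add: mat_mult)

lemma ex_bound: "finite S \<Longrightarrow> \<exists>N::nat. \<forall>s\<in>S. s < N"
  by (meson finite_nat_set_iff_bounded)

lemma vop_rec: "(vop i :: 'k::field rop) = dop i + xop i * xop (Suc i) * vop (i + 3)"
proof (intro mat_inject[THEN iffD1] ext)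
  fix S T show "mat (vop i) S T = mat (dop i + xop i * xop (Suc i) * vop (i + 3) :: 'k::field rop) S T"
  proof (cases "finite S")
    case True
    then obtain N where N: "\<forall>s\<in>S. s < N" using ex_bound by blast
    \<comment> \<open>\<open>Suc N\<close> terms are taken so that \<open>N\<close> remain for
      \<open>vop (i + 3)\<close> after the first is split off.\<close>
    then have "mat (vop i) S T = mat (vtrunc i (Suc N)) S T"
      by (intro mat_vop_trunc) auto
    also have "\<dots> = mat (dop i) S T + mat (xop i * xop (Suc i) * vtrunc (i + 3) N :: 'k rop) S T"
      by (simp add: vtrunc_Suc mat_add)
    also have "mat (xop i * xop (Suc i) * vtrunc (i + 3) N :: 'k rop) S T
        = mat (xop i * xop (Suc i) * vop (i + 3)) S T"
      by (intro mat_mult_row_cong mat_vop_trunc[symmetric] N)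
    finally show ?thesis by (simp add: mat_add)
  qed (simp add: mat_infinite)
qed

section \<open>Supercommutators of pivots\<close>

lemma anticomm_left:
  fixes a b c :: "'a::ring"
  assumes "a * b = - (b * a)"
  shows "a * (b * c) = - (b * (a * c))"
proof -
  have "a * (b * c) = a * b * c" by (simp add: mult.assoc)
  also have "\<dots> = - (b * (a * c))" unfolding assms by (simp add: mult.assoc)
  finally show ?thesis .
qed

lemmas x_anticomm_left = x_anticomm[THEN anticomm_left]
  and d_x_anticomm_left = d_x_anticomm[THEN anticomm_left]

lemma x_sq_left [simp]: "xop i * (xop i * A) = 0"
  by (simp flip: mult.assoc)

text \<open>All indices in \<open>vtrunc i N\<close> are at least \<open>i\<close>, and each summand
  has an odd number of odd factors.\<close>

lemma vtrunc_xop: "j < i \<Longrightarrow> vtrunc i N * xop j = - (xop j * vtrunc i N)"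
proof (induction N arbitrary: i)
  case (Suc N)
  have "xop i * xop (Suc i) * vtrunc (i + 3) N * xop j
      = - (xop i * (xop (Suc i) * xop j) * (vtrunc (i + 3) N :: 'a rop))"
    using Suc.IH[of "i + 3"] Suc.prems by (simp add: mult.assoc)
  also have "\<dots> = xop i * xop j * xop (Suc i) * vtrunc (i + 3) N"
    using Suc.prems by (simp add: x_anticomm_left[of "Suc i" j] mult.assoc)
  also have "\<dots> = - (xop j * (xop i * xop (Suc i) * vtrunc (i + 3) N))"
    using Suc.prems by (simp add: x_anticomm_left[of i j] mult.assoc)
  finally show ?case
    using Suc.prems by (simp add: vtrunc_Suc distrib_left distrib_right d_x_anticomm)
qed (simp add: vtrunc_def)

lemma vtrunc_dop: "j < i \<Longrightarrow> vtrunc i N * dop j = - (dop j * vtrunc i N)"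
proof (induction N arbitrary: i)
  case (Suc N)
  have "xop i * xop (Suc i) * vtrunc (i + 3) N * dop j
      = - (xop i * (xop (Suc i) * dop j) * (vtrunc (i + 3) N :: 'a rop))"
    using Suc.IH[of "i + 3"] Suc.prems by (simp add: mult.assoc)
  also have "xop (Suc i) * dop j = - (dop j * (xop (Suc i) :: 'a rop))"
    using Suc.prems by (simp add: d_x_anticomm)
  also have "- (xop i * - (dop j * xop (Suc i)) * vtrunc (i + 3) N)
      = xop i * dop j * xop (Suc i) * (vtrunc (i + 3) N :: 'a rop)"
    by (simp add: mult.assoc)
  also have "xop i * dop j = - (dop j * (xop i :: 'a rop))"
    using Suc.prems by (simp add: d_x_anticomm)
  finally show ?case
    using Suc.prems by (simp add: vtrunc_Suc distrib_left distrib_right d_anticomm[of i j] mult.assoc)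
qed (simp add: vtrunc_def)

lemma vop_xop: "j < i \<Longrightarrow> (vop i :: 'k::field rop) * xop j = - (xop j * vop i)"
proof (intro mat_inject[THEN iffD1] ext)
  fix S T assume ji: "j < i"
  show "mat (vop i * xop j) S T = mat (- (xop j * vop i) :: 'k::field rop) S T"
  proof (cases "finite S")
    case True
    \<comment> \<open>The pivot acts here on \<open>insert j S\<close>, so the bound must cover
      \<open>j\<close> as well.\<close>
    then obtain N where N: "\<forall>s\<in>insert j S. s < N" using ex_bound[of "insert j S"] by auto
    have "mat (vop i * xop j) S T = mat (vtrunc i N * xop j) S T"
      by (simp add: mat_mult_x mat_vop_trunc[OF N])
    also have "\<dots> = - mat (xop j * vtrunc i N :: 'k rop) S T"
      using ji by (simp add: vtrunc_xop mat_uminus)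
    also have "mat (xop j * vtrunc i N :: 'k rop) S T = mat (xop j * vop i) S T"
      by (intro mat_mult_row_cong mat_vop_trunc[symmetric]) (use N in auto)
    finally show ?thesis by (simp add: mat_uminus)
  qed (simp add: mat_infinite)
qed

lemma vop_dop: "j < i \<Longrightarrow> (vop i :: 'k::field rop) * dop j = - (dop j * vop i)"
proof (intro mat_inject[THEN iffD1] ext)
  fix S T assume ji: "j < i"
  show "mat (vop i * dop j) S T = mat (- (dop j * vop i) :: 'k::field rop) S T"
  proof (cases "finite S")
    case True
    then obtain N where N: "\<forall>s\<in>S. s < N" using ex_bound by auto
    then have N': "\<forall>s\<in>S - {j}. s < N" by auto
    have "mat (vop i * dop j) S T = mat (vtrunc i N * dop j) S T"
      by (simp add: mat_mult_d mat_vop_trunc[OF N'])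
    also have "\<dots> = - mat (dop j * vtrunc i N :: 'k rop) S T"
      using ji by (simp add: vtrunc_dop mat_uminus)
    also have "mat (dop j * vtrunc i N :: 'k rop) S T = mat (dop j * vop i) S T"
      by (intro mat_mult_row_cong mat_vop_trunc[symmetric]) (use N in auto)
    finally show ?thesis by (simp add: mat_uminus)
  qed (simp add: mat_infinite)
qed

lemma xop_mult_vop: "xop i * vop i = xop i * dop i"
  by (subst vop_rec) (simp add: distrib_left flip: mult.assoc)

lemma vop_xop_same: "(vop i :: 'k::field rop) * xop i = 1 - xop i * vop i"
proof -
  have "xop i * xop (Suc i) * vop (i + 3) * xop i = - (xop i * (xop (Suc i) * xop i) * (vop (i + 3) :: 'k::field rop))"
    by (simp add: vop_xop mult.assoc)
  also have "\<dots> = 0" by (simp add: x_anticomm_left[of "Suc i" i] mult.assoc)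
  finally show ?thesis
    by (subst vop_rec) (simp add: distrib_right d_x_same xop_mult_vop)
qed

text \<open>Write \<open>vop i = dop i + xop i * y\<close> with \<open>y\<close> commuting with
  \<open>xop i\<close> and \<open>dop i\<close>. The squares vanish and the cross terms give
  \<open>(dop i * xop i + xop i * dop i) * y = y\<close>.\<close>

lemma vop_sq: "(vop i :: 'k::field rop) * vop i = xop (Suc i) * vop (i + 3)"
proof -
  define y :: "'k::field rop" where "y = xop (Suc i) * vop (i + 3)"
  have v: "vop i = dop i + xop i * y" by (subst vop_rec) (simp add: y_def mult.assoc)
  have xy: "y * xop i = xop i * y" and dy: "y * dop i = dop i * y"
    unfolding y_def
    by (simp_all add: mult.assoc vop_xop vop_dop x_anticomm_left[of "Suc i" i] d_x_anticomm_left)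
  have "vop i * vop i = dop i * dop i + dop i * xop i * y + xop i * (y * dop i) + xop i * (y * xop i) * y"
    by (simp add: v algebra_simps)
  also have "\<dots> = (1 - xop i * dop i) * y + xop i * dop i * y + xop i * xop i * y * y"
    by (simp only: xy dy d_x_same d_sq) (simp add: mult.assoc)
  also have "\<dots> = y" by (simp add: algebra_simps)
  finally show ?thesis by (simp add: y_def)
qed

text \<open>The part \<open>dop i\<close> of \<open>vop i\<close> anticommutes with
  \<open>vop m\<close>, and the even pair \<open>xop i * xop (Suc i)\<close> commutes with
  it.\<close>

lemma vop_bracket_step:
  assumes "Suc i < m"
  shows "(vop i :: 'k::field rop) * vop m + vop m * vop i
    = xop i * xop (Suc i) * (vop (i + 3) * vop m + vop m * vop (i + 3))"
proof -
  have "vop m * (xop i * xop (Suc i) * vop (i + 3)) = xop i * xop (Suc i) * (vop m * (vop (i + 3) :: 'k::field rop))"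
  proof -
    have "vop m * (xop i * xop (Suc i) * vop (i + 3)) = vop m * xop i * xop (Suc i) * (vop (i + 3) :: 'k rop)"
      by (simp add: mult.assoc)
    also have "\<dots> = - (xop i * (vop m * xop (Suc i)) * vop (i + 3))"
      using assms by (simp add: vop_xop mult.assoc)
    also have "\<dots> = xop i * xop (Suc i) * (vop m * vop (i + 3))"
      using assms by (simp add: vop_xop mult.assoc)
    finally show ?thesis .
  qed
  then show ?thesis
    using assms by (subst (1 2) vop_rec[of i]) (simp add: vop_dop algebra_simps)
qed

text \<open>Now \<open>vop (Suc i)\<close> contracts the factor \<open>xop (Suc i)\<close> in the
  tail of \<open>vop i\<close>. What else remains is \<open>xop (Suc i)\<close> times a bracket that
  itself begins with \<open>xop (Suc i)\<close>, hence 0.\<close>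

lemma vop_bracket_1: "(vop i :: 'k::field rop) * vop (Suc i) + vop (Suc i) * vop i = - (xop i * vop (i + 3))"
proof -
  let ?b = "vop (i + 3) * vop (Suc i) + vop (Suc i) * vop (i + 3) :: 'k::field rop"
  have "?b = xop (Suc i) * (xop (i + 2) * (vop (i + 4) * vop (i + 3) + vop (i + 3) * vop (i + 4)))"
    using vop_bracket_step[of "Suc i" "i + 3"]
    by (subst add.commute) (simp add: mult.assoc numeral_eq_Suc)
  then obtain y where b: "?b = xop (Suc i) * y" by blast
  have xb: "xop (Suc i) * ?b = 0" unfolding b by (rule x_sq_left)
  have "vop (Suc i) * (xop i * xop (Suc i) * vop (i + 3))
      = - (xop i * (vop (Suc i) * xop (Suc i)) * (vop (i + 3) :: 'k rop))"
    by (simp add: vop_xop flip: mult.assoc)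
  also have "\<dots> = - (xop i * vop (i + 3)) + xop i * xop (Suc i) * (vop (Suc i) * vop (i + 3))"
    by (simp add: vop_xop_same algebra_simps)
  finally have "vop i * vop (Suc i) + vop (Suc i) * vop i
      = - (xop i * vop (i + 3)) + xop i * (xop (Suc i) * ?b)"
    by (subst (1 2) vop_rec[of i]) (simp add: vop_dop algebra_simps)
  then show ?thesis by (simp add: xb)
qed

section \<open>Grassmann monomials\<close>

definition xmon :: "nat set \<Rightarrow> 'k::field rop" where
  "xmon S = prod_list (map xop (sorted_list_of_set S))"

lemma xmon_empty [simp]: "xmon {} = 1"
  by (simp add: xmon_def)

lemma scal_left_commute: "A * (scal c * B) = scal c * (A * B)"
proof -
  have "A * (scal c * B) = A * scal c * B" by (simp only: mult.assoc)
  then show ?thesis by (simp only: scal_commute mult.assoc)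
qed

lemma scal_mult_left: "scal a * (scal b * A) = scal (a * b) * A"
  by (simp add: scal_mult flip: mult.assoc)

lemmas scal_simps = scal_mult_left scal_left_commute[of "xop i" for i] scal_left_commute[of "vop i" for i]
  scal_left_commute[of "xmon S" for S]

lemma xop_prod_list_zero: "i \<in> set l \<Longrightarrow> xop i * prod_list (map xop l) = (0 :: 'k::field rop)"
proof (induction l)
  case (Cons a l)
  then show ?case by (cases "i = a") (auto simp: x_anticomm_left)
qed simp

text \<open>Each smaller entry that \<open>xop i\<close> passes costs a sign. Only its being a sign
  is recorded, since the goal is proportionality.\<close>

lemma xop_prod_list_insort:
  "i \<notin> set l \<Longrightarrow> \<exists>e\<in>{1, -1 :: 'k::field}. prod_list (map xop (insort i l)) = scal e * (xop i * prod_list (map xop l))"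
proof (induction l)
  case (Cons a l)
  then have "\<exists>e\<in>{1, -1 :: 'k}. prod_list (map xop (insort i l)) = scal e * (xop i * prod_list (map xop l))"
    by simp
  then obtain e :: 'k where e: "e \<in> {1, -1}"
    "prod_list (map xop (insort i l)) = scal e * (xop i * prod_list (map xop l))" by blast
  show ?case
  proof (cases "i \<le> a")
    case False
    then have "prod_list (map xop (insort i (a # l))) = scal (- e) * (xop i * prod_list (map xop (a # l)))"
      using e Cons.prems by (auto simp: x_anticomm_left[of a i] scal_uminus)
    then show ?thesis using e by (intro bexI[of _ "- e"]) auto
  qed (auto intro!: bexI[of _ 1])
qed (auto intro!: bexI[of _ 1])

lemma xop_xmon_zero: "finite S \<Longrightarrow> i \<in> S \<Longrightarrow> xop i * xmon S = 0"
  by (simp add: xmon_def xop_prod_list_zero)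

lemma xmon_insert:
  assumes "finite S" "i \<notin> S"
  obtains e where "e \<in> {1, -1}" "xmon (insert i S) = scal e * (xop i * xmon S)"
    "xop i * xmon S = scal e * xmon (insert i S)"
proof -
  have "\<exists>e\<in>{1, -1 :: 'a}. xmon (insert i S) = scal e * (xop i * xmon S)"
    using xop_prod_list_insort[of i "sorted_list_of_set S"] assms by (simp add: xmon_def)
  then obtain e :: 'a where e: "e \<in> {1, -1}" "xmon (insert i S) = scal e * (xop i * xmon S)"
    by blast
  moreover have "xop i * xmon S = scal e * xmon (insert i S)"
    using e by (auto simp: scal_uminus)
  ultimately show ?thesis using that by blast
qed

lemma xmon_mult:
  assumes "finite S" "finite R"
  shows "(S \<inter> R = {} \<longrightarrow> (\<exists>e::'k. xmon S * xmon R = scal e * xmon (S \<union> R)))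
    \<and> (S \<inter> R \<noteq> {} \<longrightarrow> xmon S * xmon R = (0 :: 'k::field rop))"
  using assms(1)
proof (induction S rule: finite_induct)
  case empty
  then show ?case by (auto intro!: exI[of _ 1])
next
  case (insert i S)
  obtain e :: 'k where e: "xmon (insert i S) = scal e * (xop i * xmon S)"
    using xmon_insert[OF insert.hyps(1,2)] by blast
  show ?case
  proof (cases "S \<inter> R = {}")
    case False
    then show ?thesis using insert.IH e by (auto simp: mult.assoc)
  next
    case True
    with insert.IH have "\<exists>a::'k. xmon S * xmon R = scal a * xmon (S \<union> R)" by simp
    then obtain a :: 'k where a: "xmon S * xmon R = scal a * xmon (S \<union> R)" ..
    have eq: "xmon (insert i S) * xmon R = scal (e * a) * (xop i * xmon (S \<union> R))"
      using e a by (simp add: mult.assoc scal_simps)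
    have fin: "finite (S \<union> R)" using insert.hyps assms by simp
    show ?thesis
    proof (cases "i \<in> R")
      case True
      then show ?thesis by (auto simp: eq xop_xmon_zero[OF fin])
    next
      case False
      then obtain b :: 'k where "xop i * xmon (S \<union> R) = scal b * xmon (insert i (S \<union> R))"
        using xmon_insert[OF fin, of i] insert.hyps by auto
      then have "xmon (insert i S) * xmon R = scal (e * a * b) * xmon (insert i S \<union> R)"
        using eq by (simp add: scal_mult_left mult.assoc)
      then show ?thesis using True False by auto
    qed
  qed
qed

text \<open>With \<open>e\<close> left free, this serves odd and even \<open>A\<close>
  alike.\<close>

lemma scomm_xmon:
  fixes A :: "'k::field rop"
  assumes "finite S" "\<And>s. s \<in> S \<Longrightarrow> A * xop s = scal e * (xop s * A)"
  shows "A * xmon S = scal (e ^ card S) * (xmon S * A)"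
proof -
  have "A * prod_list (map xop l) = scal (e ^ length l) * (prod_list (map xop l) * A)"
    if "set l \<subseteq> S" for l
    using that
  proof (induction l)
    case (Cons a l)
    have "A * prod_list (map xop (a # l)) = A * xop a * prod_list (map xop l)"
      by (simp add: mult.assoc)
    also have "\<dots> = scal e * (xop a * (A * prod_list (map xop l)))"
      using assms(2)[of a] Cons.prems by (simp add: mult.assoc)
    also have "\<dots> = scal (e ^ length (a # l)) * (prod_list (map xop (a # l)) * A)"
      using Cons by (simp add: scal_simps mult.assoc)
    finally show ?case .
  qed simp
  from this[of "sorted_list_of_set S"] show ?thesis
    using assms(1) by (simp add: xmon_def)
qed

lemma anticomm_xmon:
  fixes A :: "'k::field rop"
  assumes "finite S" "\<And>s. s \<in> S \<Longrightarrow> A * xop s = - (xop s * A)"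
  shows "A * xmon S = scal ((-1) ^ card S) * (xmon S * A)"
  using scomm_xmon[of S A "- 1"] assms by (simp add: scal_uminus)

text \<open>Below, \<open>e\<close> is the sign with which odd operators supercommute with \<open>Y\<close>.\<close>

lemma vop_bracket_contract:
  assumes e: "e * e = (1::'k::field)"
    and x: "xop n * Y = scal e * (Y * xop n)" and d: "dop n * Y = scal e * (Y * dop n)"
  shows "vop n * (xop n * Y) + scal e * (xop n * Y * vop n) = Y"
proof -
  \<comment> \<open>Beside \<open>xop n\<close> the pivot reduces to \<open>dop n\<close>, and the
    two terms combine through \<open>dop n * xop n + xop n * dop n = 1\<close>.\<close>
  have "xop n * Y * vop n = scal e * Y * (xop n * vop n)" using x by (simp add: mult.assoc)
  also have "\<dots> = xop n * Y * dop n" using x by (simp add: xop_mult_vop mult.assoc)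
  finally have "scal e * (xop n * Y * vop n) = xop n * (scal e * (Y * dop n))"
    by (simp add: scal_simps mult.assoc)
  also have "\<dots> = xop n * dop n * Y" using d by (simp add: mult.assoc)
  finally have "scal e * (xop n * Y * vop n) = xop n * dop n * Y" .
  moreover have "vop n * (xop n * Y) = Y - xop n * dop n * Y"
    by (simp add: vop_xop_same xop_mult_vop left_diff_distrib flip: mult.assoc)
  ultimately show ?thesis by simp
qed

lemma vop_bracket_unfold:
  assumes d: "dop n * Y = scal e * (Y * dop n)"
  shows "vop n * Y - scal e * (Y * vop n)
    = xop n * xop (Suc n) * vop (n + 3) * Y - scal e * (Y * (xop n * xop (Suc n) * vop (n + 3)))"
  using d by (subst (1 2) vop_rec) (simp add: algebra_simps)

text \<open>The part \<open>dop n\<close> supercommutes with \<open>Y\<close> and drops out; the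
  even pair \<open>xop n * xop (Suc n)\<close> commutes with \<open>Y\<close> and moves to the
  front.\<close>

lemma vop_bracket_shift:
  assumes e: "e * e = (1::'k::field)"
    and x: "xop n * Y = scal e * (Y * xop n)" and d: "dop n * Y = scal e * (Y * dop n)"
    and x': "xop (Suc n) * Y = scal e * (Y * xop (Suc n))"
  shows "vop n * Y - scal e * (Y * vop n)
    = xop n * xop (Suc n) * (vop (n + 3) * Y - scal e * (Y * vop (n + 3)))"
proof -
  have "Y * xop n = scal e * (xop n * Y)" using x e
    by (simp add: scal_mult_left)
  then have "Y * xop n * xop (Suc n) = scal e * xop n * (Y * xop (Suc n))"
    by (simp add: mult.assoc)
  also have "\<dots> = xop n * (xop (Suc n) * Y)"
    unfolding x' by (simp add: scal_simps mult.assoc)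
  finally have yx: "Y * xop n * xop (Suc n) = xop n * (xop (Suc n) * Y)" .
  have "scal e * (Y * (xop n * xop (Suc n) * vop (n + 3)))
      = scal e * (Y * xop n * xop (Suc n) * vop (n + 3))"
    by (simp add: mult.assoc)
  also have "\<dots> = xop n * xop (Suc n) * (scal e * (Y * vop (n + 3)))"
    unfolding yx by (simp add: scal_simps mult.assoc)
  finally show ?thesis
    by (subst vop_bracket_unfold[OF d]) (simp add: right_diff_distrib mult.assoc)
qed

section \<open>Brackets of monomials\<close>

lemma xmon_single: "xmon {i} = xop i"
  by (simp add: xmon_def)

text \<open>The monomial has \<open>card T + 1\<close> odd factors, each of which anticommutes with
  \<open>A\<close>.\<close>

lemma odd_scomm_monomial:
  fixes A :: "'k::field rop"
  assumes "finite T" "\<And>t. t \<in> T \<Longrightarrow> A * xop t = - (xop t * A)" "A * vop m = - (vop m * A)"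
  shows "A * (xmon T * vop m) = scal (- ((-1) ^ card T)) * (xmon T * vop m * A)"
proof -
  have "A * (xmon T * vop m) = A * xmon T * vop m" by (simp add: mult.assoc)
  also have "\<dots> = scal ((-1) ^ card T) * (xmon T * (A * vop m))"
    by (simp only: anticomm_xmon[OF assms(1,2)] mult.assoc)
  finally show ?thesis by (simp add: assms(3) scal_uminus mult.assoc)
qed

lemma xop_scomm_monomial:
  assumes "finite T" "j < m"
  shows "xop j * (xmon T * vop m) = scal (- ((-1) ^ card T)) * (xmon T * vop m * xop j)"
proof (rule odd_scomm_monomial[OF assms(1)])
  show "xop j * xop t = - (xop t * xop j)" for t
    by (cases "t = j") (simp_all add: x_anticomm[of j t])
qed (simp add: vop_xop[OF assms(2)])

lemma dop_scomm_monomial: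
  assumes "finite T" "j < m" "j \<notin> T"
  shows "dop j * (xmon T * vop m) = scal (- ((-1) ^ card T)) * (xmon T * vop m * dop j)"
proof (rule odd_scomm_monomial[OF assms(1)])
  show "dop j * xop t = - (xop t * dop j)" if "t \<in> T" for t
    using that assms(3) by (intro d_x_anticomm) auto
qed (simp add: vop_dop[OF assms(2)])

text \<open>Since \<open>vop k\<close> anticommutes with every factor of \<open>xmon T\<close>, only
  a bracket of two pivots remains.\<close>

lemma vop_bracket_outer:
  assumes "finite T" "\<And>t. t \<in> T \<Longrightarrow> t < k"
  shows "vop k * (xmon T * vop m) - scal (- ((-1) ^ card T)) * (xmon T * vop m * vop k)
    = scal ((-1) ^ card T) * (xmon T * (vop k * vop m + vop m * vop k))"
proof -
  have "vop k * (xmon T * vop m) = vop k * xmon T * vop m" by (simp add: mult.assoc)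
  also have "\<dots> = scal ((-1) ^ card T) * (xmon T * (vop k * vop m))"
    by (subst anticomm_xmon[OF assms(1)]) (use assms(2) in \<open>auto simp: vop_xop mult.assoc\<close>)
  finally show ?thesis by (simp add: scal_uminus distrib_left mult.assoc)
qed

text \<open>The last clause allows any further factor \<open>x\<^sub>S\<close> with \<open>S \<subseteq> {0..n-2}\<close>. It survives the
  substitution of \<open>x\<^sub>n x\<^sub>n\<^sub>+\<^sub>1 v\<^sub>n\<^sub>+\<^sub>3\<close> for \<open>v\<^sub>n\<close> because \<open>n + 1 = (n + 3) - 2\<close>.\<close>
definition bracket_monomial :: "nat \<Rightarrow> nat set \<Rightarrow> nat \<Rightarrow> 'k::field rop \<Rightarrow> bool" where
  "bracket_monomial n T m A \<longleftrightarrow> A = 0 \<or> (\<exists>c R r. A = scal c * (xmon R * vop r) \<and> finite R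
    \<and> (\<forall>f. pivot_rec f \<longrightarrow> weight f R r = f n + weight f T m)
    \<and> (\<forall>S. (\<forall>s\<in>S. s + 2 \<le> n) \<longrightarrow> admissible r (S \<union> R)))"

text \<open>Weight and admissibility matter only for disjoint \<open>P\<close> and \<open>R\<close>,
  because a repeated generator makes the product 0.\<close>

lemma bracket_monomialI:
  assumes "A = scal c * (xmon P * xmon R * vop r)" "finite P" "finite R"
    and "\<And>f. P \<inter> R = {} \<Longrightarrow> pivot_rec f \<Longrightarrow> weight f (P \<union> R) r = f n + weight f T m"
    and "\<And>S. P \<inter> R = {} \<Longrightarrow> (\<And>s. s \<in> S \<Longrightarrow> s + 2 \<le> n) \<Longrightarrow> admissible r (S \<union> (P \<union> R))"
  shows "bracket_monomial n T m A"
proof (cases "P \<inter> R = {}")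
  case True
  then obtain a :: 'a where "xmon P * xmon R = scal a * xmon (P \<union> R)"
    using xmon_mult[OF assms(2,3)] by blast
  then have "A = scal (c * a) * (xmon (P \<union> R) * vop r)"
    using assms(1) by (simp add: scal_mult_left mult.assoc)
  then show ?thesis
    unfolding bracket_monomial_def using assms(2-) True
    by (intro disjI2 exI[of _ "c * a"] exI[of _ "P \<union> R"] exI[of _ r]) simp
next
  case False
  then have "xmon P * xmon R = (0 :: 'a rop)" using xmon_mult[OF assms(2,3)] by blast
  then show ?thesis using assms(1) by (simp add: bracket_monomial_def)
qed

text \<open>If \<open>n \<in> T\<close>, the pivot contracts \<open>x_n\<close>; if \<open>n\<close>
  and \<open>m\<close> differ by at most 1, the pivot formulas apply; otherwise \<open>n\<close> is
  raised to \<open>n + 3\<close>. The bound \<open>n \<le> Suc m\<close> survives this, as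
  \<open>Suc n < m\<close> gives \<open>n + 3 \<le> Suc m\<close>.\<close>

lemma vop_bracket_monomial:
  assumes "n \<le> Suc m" "admissible m T"
  shows "bracket_monomial n T m
    (vop n * (xmon T * vop m) - scal (- ((-1) ^ card T)) * (xmon T * vop m * vop n) :: 'k::field rop)"
  using assms(1)
proof (induction "Suc m - n" arbitrary: n rule: less_induct)
  case less
  define Y :: "'k rop" where "Y = xmon T * vop m"
  define e :: 'k where "e = - ((-1) ^ card T)"
  have ee: "e * e = 1" by (simp add: e_def flip: power_add)
  let ?br = "\<lambda>k. vop k * Y - scal e * (Y * vop k)"
  have Tm: "t < m" "t + 2 \<le> m" if "t \<in> T" for t
    using assms(2) that unfolding admissible_def by force+
  have fin: "finite T" using admissible_subset[OF assms(2)] finite_subset by blast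
  have outer: "?br k = scal (- e) * (xmon T * (vop k * vop m + vop m * vop k))"
    if "\<And>t. t \<in> T \<Longrightarrow> t < k" for k
    using vop_bracket_outer[OF fin that, where m = m] by (simp add: Y_def e_def)
  have xY: "xop j * Y = scal e * (Y * xop j)" if "j < m" for j
    using xop_scomm_monomial[OF fin that] by (simp add: Y_def e_def)
  have dY: "dop j * Y = scal e * (Y * dop j)" if "j < m" "j \<notin> T" for j
    using dop_scomm_monomial[OF fin that] by (simp add: Y_def e_def)
  have f3: "f (k + 3) = 2 * f k + f (Suc k)" if "pivot_rec f" for f k
    using that by (simp add: pivot_rec_def)
  have "bracket_monomial n T m (?br n)"
  proof -
    consider "n \<in> T" | "n \<notin> T" "n = m" | "n \<notin> T" "n = Suc m" | "n \<notin> T" "Suc n = m"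
      | "n \<notin> T" "Suc n < m"
      using less.prems by linarith
    then show ?thesis
    proof cases
      case 1
      define T' where "T' = T - {n}"
      have T: "T = insert n T'" "n \<notin> T'" "finite T'" using 1 fin by (auto simp: T'_def)
      obtain a :: 'k where a: "xmon T = scal a * (xop n * xmon T')"
        using xmon_insert[OF T(3,2)] T(1) by metis
      define Y' :: "'k rop" where "Y' = xmon T' * vop m"
      have Y: "Y = scal a * (xop n * Y')" by (simp add: Y_def Y'_def a mult.assoc)
      have e: "e = (-1) ^ card T'" using T by (simp add: e_def)
      have nm: "n < m" using Tm 1 by blast
      have "vop n * (xop n * Y') + scal (- e) * (xop n * Y' * vop n) = Y'"
        by (rule vop_bracket_contract)
          (use ee xop_scomm_monomial[OF T(3) nm] dop_scomm_monomial[OF T(3) nm T(2)] in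
            \<open>simp_all add: e Y'_def\<close>)
      then have eq: "vop n * (xop n * Y') - scal e * (xop n * Y' * vop n) = Y'"
        by (simp add: scal_uminus)
      have "?br n = scal a * (vop n * (xop n * Y')) - scal a * (scal e * (xop n * Y' * vop n))"
        by (simp add: Y scal_simps mult.assoc mult.commute[of e a])
      also have "\<dots> = scal a * Y'" by (simp only: right_diff_distrib[symmetric] eq)
      finally have "?br n = scal a * Y'" .
      then have br: "?br n = scal a * (xmon {} * xmon T' * vop m)" by (simp add: Y'_def)
      show ?thesis
      proof (rule bracket_monomialI[OF br])
        show "weight f ({} \<union> T') m = f n + weight f T m" for f
          using T by (simp add: weight_def)
        fix S assume S: "\<And>s. s \<in> S \<Longrightarrow> s + 2 \<le> n"
        \<comment> \<open>Elements of \<open>S\<close> stay below \<open>m - 3\<close>, so a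
          forbidden pair would lie entirely in \<open>T'\<close>.\<close>
        have "s + 4 \<le> m" if "s \<in> S" for s using S[OF that] Tm(2)[OF 1] by linarith
        then show "admissible m (S \<union> ({} \<union> T'))"
          using assms(2) T(1) unfolding admissible_def by (simp, safe; force)
      qed (use T in auto)
    next
      case 2
      have "?br n = scal (- e) * (xmon T * (vop m * vop m + vop m * vop m))"
        using outer[of n] 2 Tm(1) by blast
      also have "\<dots> = (scal (- e) + scal (- e)) * (xmon T * (xop (Suc m) * vop (m + 3)))"
        by (simp only: vop_sq distrib_left distrib_right)
      \<comment> \<open>In characteristic 2 this coefficient is 0; squares of odd elements are
        treated separately.\<close>
      also have "scal (- e) + scal (- e) = scal (- 2 * e)"
        by (subst scal_add[symmetric]) simp
      finally have "?br n = scal (- 2 * e) * (xmon T * (xop (Suc m) * vop (m + 3)))" .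
      then have br: "?br n = scal (- 2 * e) * (xmon T * xmon {Suc m} * vop (m + 3))"
        by (simp add: xmon_single mult.assoc)
      show ?thesis
      proof (rule bracket_monomialI[OF br])
        show "weight f (T \<union> {Suc m}) (m + 3) = f n + weight f T m"
          if "T \<inter> {Suc m} = {}" "pivot_rec f" for f
          using that 2 fin f3[of f m] by (simp add: weight_def sum.union_disjoint)
        \<comment> \<open>The forbidden pair for \<open>m + 3\<close> is \<open>m, Suc m\<close>,
          and \<open>m\<close> lies in none of the three sets.\<close>
        fix S assume S: "\<And>s. s \<in> S \<Longrightarrow> s + 2 \<le> n"
        then show "admissible (m + 3) (S \<union> (T \<union> {Suc m}))"
          using 2 Tm(2) unfolding admissible_def by force
      qed (use fin in auto)
    next
      case 3
      have "?br n = scal (- e) * (xmon T * (vop m * vop (Suc m) + vop (Suc m) * vop m))"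
        using outer[of n] 3 Tm(1) by (simp add: less_SucI add.commute)
      then have br: "?br n = scal e * (xmon T * xmon {m} * vop (m + 3))"
        by (simp add: vop_bracket_1 xmon_single scal_uminus mult.assoc)
      show ?thesis
      proof (rule bracket_monomialI[OF br])
        show "weight f (T \<union> {m}) (m + 3) = f n + weight f T m"
          if "T \<inter> {m} = {}" "pivot_rec f" for f
          using that 3 fin f3[of f m] by (simp add: weight_def sum.union_disjoint)
        fix S assume S: "\<And>s. s \<in> S \<Longrightarrow> s + 2 \<le> n"
        then show "admissible (m + 3) (S \<union> (T \<union> {m}))"
          using 3 Tm(2) unfolding admissible_def by force
      qed (use fin in auto)
    next
      case 4
      have "t < n" if "t \<in> T" for t using Tm(1)[OF that] that 4 by (metis less_SucE)
      then have "?br n = scal (- e) * (xmon T * (vop n * vop (Suc n) + vop (Suc n) * vop n))"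
        using outer[of n] 4 by simp
      then have br: "?br n = scal e * (xmon T * xmon {n} * vop (n + 3))"
        by (simp add: vop_bracket_1 xmon_single scal_uminus mult.assoc)
      show ?thesis
      proof (rule bracket_monomialI[OF br])
        show "weight f (T \<union> {n}) (n + 3) = f n + weight f T m"
          if "T \<inter> {n} = {}" "pivot_rec f" for f
          using that 4 fin f3[of f n] by (auto simp: weight_def sum.union_disjoint)
        fix S assume S: "\<And>s. s \<in> S \<Longrightarrow> s + 2 \<le> n"
        then show "admissible (n + 3) (S \<union> (T \<union> {n}))"
          using 4 Tm(2) unfolding admissible_def by force
      qed (use fin in auto)
    next
      case 5
      have shift: "?br n = xop n * xop (Suc n) * ?br (n + 3)"
        by (rule vop_bracket_shift[OF ee]) (use xY dY 5 in auto)
      have "bracket_monomial (n + 3) T m (?br (n + 3))"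
        using less.hyps[of "n + 3"] 5 by (simp add: Y_def e_def)
      then consider "?br (n + 3) = 0"
        | c R r where "?br (n + 3) = scal c * (xmon R * vop r)" "finite R"
          "\<forall>f. pivot_rec f \<longrightarrow> weight f R r = f (n + 3) + weight f T m"
          "\<forall>S. (\<forall>s\<in>S. s + 2 \<le> n + 3) \<longrightarrow> admissible r (S \<union> R)"
        unfolding bracket_monomial_def by blast
      then show ?thesis
      proof cases
        case 1
        then show ?thesis using shift by (simp add: bracket_monomial_def)
      next
        case (2 c R r)
        obtain a :: 'k where a: "xop n * xop (Suc n) = scal a * xmon {n, Suc n}"
          using xmon_insert[of "{Suc n}" n] by (auto simp: xmon_single)
        have br: "?br n = scal (a * c) * (xmon {n, Suc n} * xmon R * vop r)"
          unfolding shift 2(1) a by (simp add: scal_simps mult.assoc)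
        show ?thesis
        proof (rule bracket_monomialI[OF br])
          show "weight f ({n, Suc n} \<union> R) r = f n + weight f T m"
            if "{n, Suc n} \<inter> R = {}" "pivot_rec f" for f
            using that 2(2,3) f3[of f n] by (auto simp: weight_def)
          fix S assume S: "\<And>s. s \<in> S \<Longrightarrow> s + 2 \<le> n"
          then have "\<forall>s\<in>S \<union> {n, Suc n}. s + 2 \<le> n + 3" by force
          then show "admissible r (S \<union> ({n, Suc n} \<union> R))"
            using 2(4) by (metis sup_assoc)
        qed (use 2 in auto)
      qed
    qed
  qed
  then show ?case by (simp add: Y_def e_def)
qed

section \<open>Multidegrees\<close>

definition degree_weight :: "(nat \<Rightarrow> int) \<Rightarrow> mdeg \<Rightarrow> int" where
  "degree_weight f d = int (fst d) * f 0 + int (fst (snd d)) * f 1 + int (snd (snd d)) * f 2"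

lemma degree_weight_dadd: "degree_weight f (dadd d e) = degree_weight f d + degree_weight f e"
  by (simp add: degree_weight_def dadd_def algebra_simps)

definition of_degree :: "nat set \<Rightarrow> nat \<Rightarrow> mdeg \<Rightarrow> bool" where
  "of_degree S n d \<longleftrightarrow> admissible n S \<and> (\<forall>f. pivot_rec f \<longrightarrow> weight f S n = degree_weight f d)"

lemma of_degree_unique: "of_degree S n d \<Longrightarrow> of_degree T m d \<Longrightarrow> S = T \<and> n = m"
  by (rule admissible_same_weight_unique) (auto simp: of_degree_def same_weight_def)

lemma of_degree_finite: "of_degree S n d \<Longrightarrow> finite S"
  unfolding of_degree_def by (meson admissible_subset finite_lessThan finite_subset)

text \<open>The solution with initial values 1, 1, 1 evaluates the weight to the total degree, whose
  parity is that of \<open>card S + 1\<close>.\<close>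

lemma of_degree_parity:
  assumes "of_degree S n d"
  shows "even (dtot d) \<longleftrightarrow> odd (card S)"
proof -
  have "weight (pivot_seq 1 1 1) S n = int (dtot d)"
    using assms pivot_rec_pivot_seq[of 1 1 1]
    by (simp add: of_degree_def degree_weight_def dtot_def numeral_2_eq_2)
  then show ?thesis using even_weight_111_iff[OF of_degree_finite[OF assms], of n] by simp
qed

text \<open>All elements of \<open>S\<close> lie below \<open>n \<le> m\<close>, so
  \<open>xmon S\<close> can be pulled out on the left, leaving the bracket of \<open>vop n\<close>
  with \<open>xmon T * vop m\<close>.\<close>

lemma bracket_monomials_le:
  assumes "n \<le> m" "of_degree S n d" "of_degree T m e"
  obtains c R r where
    "xmon S * vop n * (xmon T * vop m)
      - scal ((-1) ^ (dtot d * dtot e)) * (xmon T * vop m * (xmon S * vop n))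
      = scal c * (xmon R * vop r :: 'k::field rop)"
    "c \<noteq> 0 \<longrightarrow> of_degree R r (dadd d e)"
proof -
  define Y :: "'k rop" where "Y = xmon T * vop m"
  define a :: 'k where "a = - ((-1) ^ card T)"
  have aa: "a * a = 1" by (simp add: a_def flip: power_add)
  have finS: "finite S" and finT: "finite T" using assms of_degree_finite by auto
  have Sn: "s + 2 \<le> n" if "s \<in> S" for s
    using assms(2) that by (auto simp: of_degree_def admissible_def)
  have "Y * xop s = scal a * (xop s * Y)" if "s \<in> S" for s
  proof -
    have "s < m" using Sn[OF that] assms(1) by linarith
    then have "xop s * Y = scal a * (Y * xop s)"
      using xop_scomm_monomial[OF finT] by (simp add: Y_def a_def)
    then show ?thesis using aa by (simp add: scal_mult_left)
  qed
  then have YS: "Y * xmon S = scal (a ^ card S) * (xmon S * Y)"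
    by (rule scomm_xmon[OF finS])
  \<comment> \<open>The bracket sign times the sign of moving \<open>xmon S\<close> past
    \<open>Y\<close> is the sign for the single odd operator \<open>vop n\<close>.\<close>
  have sign: "(-1) ^ (dtot d * dtot e) * a ^ card S = a"
    using of_degree_parity[OF assms(2)] of_degree_parity[OF assms(3)]
    by (cases "even (card S)"; cases "even (card T)") (simp_all add: a_def minus_one_power_iff)
  let ?A = "vop n * Y - scal a * (Y * vop n)"
  have "Y * (xmon S * vop n) = Y * xmon S * vop n" by (simp add: mult.assoc)
  then have "scal ((-1) ^ (dtot d * dtot e)) * (Y * (xmon S * vop n)) = scal a * (xmon S * (Y * vop n))"
    by (simp add: YS scal_mult_left sign mult.assoc)
  then have eq: "xmon S * vop n * Y - scal ((-1) ^ (dtot d * dtot e)) * (Y * (xmon S * vop n)) = xmon S * ?A"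
    by (simp add: right_diff_distrib scal_simps mult.assoc)
  have "bracket_monomial n T m ?A"
    using vop_bracket_monomial[of n m T, where 'k = 'k] assms by (simp add: Y_def a_def of_degree_def)
  then consider "?A = 0" | c R r where "?A = scal c * (xmon R * vop r)" "finite R"
      "\<forall>f. pivot_rec f \<longrightarrow> weight f R r = f n + weight f T m"
      "\<forall>S. (\<forall>s\<in>S. s + 2 \<le> n) \<longrightarrow> admissible r (S \<union> R)"
    unfolding bracket_monomial_def by blast
  then show thesis
  proof cases
    case 1
    then show thesis using eq that[of 0] by (simp add: Y_def)
  next
    case (2 c R r)
    have SA: "xmon S * ?A = scal c * (xmon S * xmon R * vop r)"
      unfolding 2(1) by (simp add: scal_simps mult.assoc)
    show thesis
    proof (cases "S \<inter> R = {}")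
      case False
      then have "xmon S * xmon R = (0 :: 'k rop)" using xmon_mult[OF finS 2(2)] by blast
      then show thesis using eq SA that[of 0] by (simp add: Y_def)
    next
      case True
      then obtain b :: 'k where "xmon S * xmon R = scal b * xmon (S \<union> R)"
        using xmon_mult[OF finS 2(2)] by blast
      then have "xmon S * ?A = scal (c * b) * (xmon (S \<union> R) * vop r)"
        unfolding SA by (simp add: scal_mult_left mult.assoc)
      moreover have "of_degree (S \<union> R) r (dadd d e)"
        unfolding of_degree_def
      proof (intro conjI allI impI)
        show "admissible r (S \<union> R)" using 2(4) Sn by blast
        fix f assume f: "pivot_rec f"
        have "weight f (S \<union> R) r = weight f S n + weight f T m"
          using True finS 2(2,3) f by (simp add: weight_def sum.union_disjoint)
        then show "weight f (S \<union> R) r = degree_weight f (dadd d e)"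
          using f assms(2,3) by (simp add: of_degree_def degree_weight_dadd)
      qed
      ultimately show thesis using eq that[of "c * b" "S \<union> R" r] by (simp add: Y_def)
    qed
  qed
qed

text \<open>Super skew-symmetry reduces to \<open>n \<le> m\<close> at the cost of a sign.\<close>

lemma bracket_monomials:
  assumes "of_degree S n d" "of_degree T m e"
  obtains c R r where
    "xmon S * vop n * (xmon T * vop m)
      - scal ((-1) ^ (dtot d * dtot e)) * (xmon T * vop m * (xmon S * vop n))
      = scal c * (xmon R * vop r :: 'k::field rop)"
    "c \<noteq> 0 \<longrightarrow> of_degree R r (dadd d e)"
proof (cases "n \<le> m")
  case True
  show thesis by (rule bracket_monomials_le[OF True assms]) (rule that)
next
  case False
  let ?s = "(-1) ^ (dtot d * dtot e) :: 'k"
  let ?B = "xmon S * vop n :: 'k rop" and ?C = "xmon T * vop m :: 'k rop"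
  have "m \<le> n" using False by simp
  obtain c R r where *: "?C * ?B - scal ((-1) ^ (dtot e * dtot d)) * (?B * ?C) = scal c * (xmon R * vop r)"
    "c \<noteq> 0 \<longrightarrow> of_degree R r (dadd e d)"
    by (rule bracket_monomials_le[OF \<open>m \<le> n\<close> assms(2,1)])
  have ss: "?s * ?s = 1" by (simp flip: power_add)
  have "?B * ?C - scal ?s * (?C * ?B) = scal (- ?s) * (?C * ?B - scal ?s * (?B * ?C))"
    by (simp add: right_diff_distrib scal_uminus) (simp add: scal_mult_left ss)
  also have "\<dots> = scal (- ?s * c) * (xmon R * vop r)"
    using *(1) by (simp only: mult.commute[of "dtot e"] scal_mult_left)
  finally show thesis
    using that[of "- ?s * c" R r] *(2) by (auto simp: dadd_def add.commute)
qed

section \<open>Lie products as multiples of monomials\<close>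

lemma mat_bracket:
  "sbracket d e (mat B) (mat C) = mat (B * C - scal ((-1) ^ (dtot d * dtot e)) * (C * B))"
proof -
  have "mat (B * C - scal ((-1) ^ (dtot d * dtot e)) * (C * B))
      = mat (B * C + scal (- ((-1) ^ (dtot d * dtot e))) * (C * B))"
    by (simp add: scal_uminus)
  also have "\<dots> = sbracket d e (mat B) (mat C)"
    by (simp only: plus_rop.rep_eq mat_scal_mult) (simp only: times_rop.rep_eq sbracket_def)
  finally show ?thesis ..
qed

text \<open>The form is inherited by brackets and squares. Products that vanish get coefficient 0
  with an arbitrary monomial, hence the condition on \<open>c\<close>.\<close>

lemma lie_mon_monomial:
  fixes A :: "'k::field op"
  shows "lie_mon d A \<Longrightarrow> \<exists>c S n. A = mat (scal c * (xmon S * vop n)) \<and> (c \<noteq> 0 \<longrightarrow> of_degree S n d)"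
proof (induction rule: lie_mon.induct)
  case gen0
  show ?case
    by (intro exI[of _ 1] exI[of _ "{}"] exI[of _ 0])
      (simp add: vop.rep_eq of_degree_def admissible_def weight_def degree_weight_def)
next
  case gen1
  show ?case
    by (intro exI[of _ 1] exI[of _ "{}"])
      (simp add: vop.rep_eq of_degree_def admissible_def weight_def degree_weight_def)
next
  case gen2
  show ?case
    by (intro exI[of _ 1] exI[of _ "{}"] exI[of _ 2])
      (simp add: vop.rep_eq of_degree_def admissible_def weight_def degree_weight_def)
next
  case (br d A e B)
  obtain a S n where A: "A = mat (scal a * (xmon S * vop n))" "a \<noteq> 0 \<Longrightarrow> of_degree S n d"
    using br.IH by blast
  obtain b T m where B: "B = mat (scal b * (xmon T * vop m))" "b \<noteq> 0 \<Longrightarrow> of_degree T m e"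
    using br.IH by blast
  show ?case
  proof (cases "a = 0 \<or> b = 0")
    case True
    then have "sbracket d e A B = mat (scal 0 * (xmon {} * vop 0))"
      unfolding A(1) B(1) mat_bracket by auto
    then show ?thesis by blast
  next
    case False
    then have deg: "of_degree S n d" "of_degree T m e" using A(2) B(2) by auto
    obtain c :: 'k and R r where c: "xmon S * vop n * (xmon T * vop m)
        - scal ((-1) ^ (dtot d * dtot e)) * (xmon T * vop m * (xmon S * vop n))
        = scal c * (xmon R * vop r)" "c \<noteq> 0 \<longrightarrow> of_degree R r (dadd d e)"
      by (rule bracket_monomials[OF deg])
    let ?M = "xmon S * vop n :: 'k rop" and ?N = "xmon T * vop m :: 'k rop"
    let ?s = "scal ((-1) ^ (dtot d * dtot e))"
    have "scal a * ?M * (scal b * ?N) - ?s * (scal b * ?N * (scal a * ?M))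
        = scal (a * b) * (?M * ?N - ?s * (?N * ?M))"
      by (simp add: scal_simps right_diff_distrib mult.assoc mult.commute mult.left_commute)
    then have "sbracket d e A B = mat (scal (a * b * c) * (xmon R * vop r))"
      unfolding A(1) B(1) mat_bracket c(1) by (simp add: scal_mult_left)
    then show ?thesis using c(2) by (metis mult_zero_right)
  qed
next
  case (sq d A)
  obtain a S n where A: "A = mat (scal a * (xmon S * vop n))" "a \<noteq> 0 \<Longrightarrow> of_degree S n d"
    using sq.IH by blast
  let ?M = "xmon S * vop n :: 'k rop"
  have AA: "op_comp A A = mat (scal (a * a) * (?M * ?M))"
    unfolding A(1) times_rop.rep_eq[symmetric] by (simp add: scal_simps mult.assoc)
  show ?case
  proof (cases "a = 0 \<or> S \<noteq> {}")
    case True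
    have "scal (a * a) * (?M * ?M) = 0"
    proof (cases "a = 0")
      case False
      then have deg: "of_degree S n d" and S: "S \<noteq> {}" using A(2) True by auto
      have "s < n" if "s \<in> S" for s
        using admissible_subset[of n S] deg that by (auto simp: of_degree_def)
      \<comment> \<open>Moving \<open>vop n\<close> past \<open>xmon S\<close> brings two copies of
        \<open>xmon S\<close> together, whose product is 0 for nonempty \<open>S\<close>.\<close>
      then have vS: "vop n * xmon S = scal ((-1) ^ card S) * (xmon S * (vop n :: 'k rop))"
        by (intro anticomm_xmon of_degree_finite[OF deg] vop_xop)
      have "?M * ?M = xmon S * (vop n * xmon S) * vop n" by (simp add: mult.assoc)
      also have "\<dots> = scal ((-1) ^ card S) * (xmon S * xmon S * vop n * vop n)"
        unfolding vS by (simp add: scal_simps mult.assoc)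
      finally have "?M * ?M = scal ((-1) ^ card S) * (xmon S * xmon S * vop n * vop n)" .
      moreover have "xmon S * xmon S = (0 :: 'k rop)"
        by (rule xmon_mult[THEN conjunct2, rule_format]) (use of_degree_finite[OF deg] S in auto)
      ultimately show ?thesis by simp
    qed simp
    then have "op_comp A A = mat (scal 0 * (xmon {} * vop 0))" using AA by simp
    then show ?thesis by blast
  next
    case False
    then have deg: "of_degree {} n d" using A(2) by auto
    have "op_comp A A = mat (scal (a * a) * (xmon {Suc n} * vop (n + 3)))"
      using AA False by (simp add: vop_sq xmon_single)
    moreover have "of_degree {Suc n} (n + 3) (dadd d d)"
      unfolding of_degree_def
    proof (intro conjI allI impI)
      fix f assume f: "pivot_rec f"
      have "f n = degree_weight f d" using deg f by (simp add: of_degree_def weight_def)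
      moreover have "f (n + 3) = 2 * f n + f (Suc n)" using f by (simp add: pivot_rec_def)
      ultimately show "weight f {Suc n} (n + 3) = degree_weight f (dadd d d)"
        by (simp add: weight_def degree_weight_dadd)
    qed (simp add: admissible_def)
    ultimately show ?thesis by blast
  qed
qed

text \<open>The witness is the unique admissible monomial of degree \<open>d\<close>; if there is
  none, every Lie product of that degree is 0.\<close>

lemma lie_mon_proportional: "\<exists>w. \<forall>A. lie_mon d A \<longrightarrow> (\<exists>c. A = op_scale c w)"
proof (cases "\<exists>S n. of_degree S n d")
  case True
  then obtain S n where deg: "of_degree S n d" by blast
  have "\<exists>c. A = op_scale c (mat (xmon S * vop n))" if mon: "lie_mon d A" for A :: "'a op"
  proof -
    obtain c T m where A: "A = mat (scal c * (xmon T * vop m))" "c \<noteq> 0 \<longrightarrow> of_degree T m d"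
      using lie_mon_monomial[OF mon] by blast
    show ?thesis
    proof (cases "c = 0")
      case True
      then have "A = mat (scal 0 * (xmon S * vop n))" using A(1) by simp
      then show ?thesis unfolding mat_scal_mult by blast
    next
      case False
      then have "T = S" "m = n" using A(2) of_degree_unique deg by blast+
      then show ?thesis using A(1) unfolding mat_scal_mult by blast
    qed
  qed
  then show ?thesis by blast
next
  case False
  have "\<exists>c. A = op_scale c op_zero" if "lie_mon d A" for A :: "'a op"
    using lie_mon_monomial[OF that] False
    by (auto simp: op_scale_def op_zero_def zero_rop.rep_eq)
  then show ?thesis by blast
qed

theorem theorem7p2:
  fixes n1 n2 n3 :: nat
  shows "\<exists>w :: 'k::field op. \<forall>q \<in> Qcomp (n1, n2, n3). \<exists>c. q = op_scale c w"
proof -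
  obtain w :: "'k op" where w: "\<And>A. lie_mon (n1, n2, n3) A \<Longrightarrow> \<exists>c. A = op_scale c w"
    using lie_mon_proportional by blast
  have "\<exists>c. q = op_scale c w" if "q \<in> Qcomp (n1, n2, n3)" for q
    using that
  proof induction
    case zero
    have "op_zero = op_scale 0 w" by (simp add: op_zero_def op_scale_def)
    then show ?case by blast
  next
    case (step A q c)
    then obtain a b where "A = op_scale a w" "q = op_scale b w" using w by blast
    then have "op_add (op_scale c A) q = op_scale (c * a + b) w"
      by (simp add: op_add_def op_scale_def algebra_simps)
    then show ?case by blast
  qed
  then show ?thesis by blast
qed

end
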